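(* Let $G$ be a finite abelian group with dual group $\widehat{G}$ and trivial character $\chi_0$, let $f$ be a nonnegative, nonzero function on $G$, and let $h$ be its pointwise square root, $h(x)=\sqrt{f(x)}$ for $x\in G$. Let $h=\sum_{\chi\in\widehat{G}} a_\chi \chi$ be the Fourier expansion of $h$, and define the matrix $Q_0\in\mathbb{C}^{\widehat{G}\times\widehat{G}}$ by $$Q_0(\chi,\chi')=\overline{a_\chi}\,a_{\chi'},\qquad \chi,\chi'\in\widehat{G}.$$ Then $Q_0$ is an optimal solution of the semidefinite program $$\min_{Q\in\mathbb{C}^{\widehat{G}\times\widehat{G}}}\ \sum_{\chi\neq\chi_0}Q(\chi,\chi)\quad\text{s.t.}\quad \sum_{\substack{\chi',\chi''\in\widehat{G}\\ \chi'^{-1}\chi''=\chi}}Q(\chi',\chi'')=\widehat{f}(\chi)\ \ \text{for all }\chi\in\widehat{G},\qquad Q\succeq 0.$$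
   Context: For a finite abelian group $G$, $\widehat{G}$ is the group of characters $\chi:G\to\mathbb{C}^*$ under pointwise multiplication, and $\chi_0\equiv 1$ is its identity. Every function $f:G\to\mathbb{C}$ has a unique Fourier expansion $f=\sum_{\chi\in\widehat{G}}\widehat{f}(\chi)\chi$. Matrices in $\mathbb{C}^{\widehat{G}\times\widehat{G}}$ have rows and columns indexed by $\widehat{G}$; $Q\succeq 0$ means that $Q$ is Hermitian positive semidefinite. *)

theory Defs
  imports "HOL-Algebra.Algebra" "HOL-Library.Complex_Order"
begin

definition nonzero_complex :: "complex monoid" where
  "nonzero_complex = \<lparr>carrier = - {0}, monoid.mult = (*), one = 1\<rparr>"

text \<open>
  Characters are functions on the carrier of the group only; they are represented as extensional
  functions, so that each character is represented exactly once.
\<close>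

definition dual_group :: "('a, 'b) monoid_scheme \<Rightarrow> ('a \<Rightarrow> complex) monoid" where
  "dual_group G =
     \<lparr>carrier = hom G nonzero_complex \<inter> extensional (carrier G),
      monoid.mult = (\<lambda>\<chi> \<psi>. \<lambda>x\<in>carrier G. \<chi> x * \<psi> x),
      one = (\<lambda>x\<in>carrier G. 1)\<rparr>"

definition is_fourier_expansion ::
    "('a, 'b) monoid_scheme \<Rightarrow> ('a \<Rightarrow> complex) \<Rightarrow> (('a \<Rightarrow> complex) \<Rightarrow> complex) \<Rightarrow> bool" where
  "is_fourier_expansion G f c \<longleftrightarrow>
     (\<forall>x\<in>carrier G. f x = (\<Sum>\<chi>\<in>carrier (dual_group G). c \<chi> * \<chi> x))"

text \<open>
  For a finite abelian group the expansion exists and its coefficients on the dual group are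
  unique; extensionality makes the coefficient function itself unique.
\<close>

definition fourier_coeff ::
    "('a, 'b) monoid_scheme \<Rightarrow> ('a \<Rightarrow> complex) \<Rightarrow> ('a \<Rightarrow> complex) \<Rightarrow> complex" where
  "fourier_coeff G f =
     (THE c. c \<in> extensional (carrier (dual_group G)) \<and> is_fourier_expansion G f c)"

text \<open>
  A complex matrix with rows and columns indexed by a finite set \<open>I\<close> is a function of two indices,
  of which only the entries in \<open>I\<close> matter. The order on the complex numbers is the one of
  \<^theory>\<open>HOL-Library.Complex_Order\<close>: \<open>z \<le> w\<close> means \<open>Re z \<le> Re w\<close> and \<open>Im z = Im w\<close>.
\<close>

definition hermitian_psd :: "'i set \<Rightarrow> ('i \<Rightarrow> 'i \<Rightarrow> complex) \<Rightarrow> bool" where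
  "hermitian_psd I Q \<longleftrightarrow>
     (\<forall>i\<in>I. \<forall>j\<in>I. Q j i = cnj (Q i j)) \<and>
     (\<forall>v :: 'i \<Rightarrow> complex. 0 \<le> (\<Sum>i\<in>I. \<Sum>j\<in>I. cnj (v i) * Q i j * v j))"

definition sdp_feasible ::
    "('a, 'b) monoid_scheme \<Rightarrow> ('a \<Rightarrow> complex) \<Rightarrow>
     (('a \<Rightarrow> complex) \<Rightarrow> ('a \<Rightarrow> complex) \<Rightarrow> complex) \<Rightarrow> bool" where
  "sdp_feasible G f Q \<longleftrightarrow>
     (\<forall>\<chi>\<in>carrier (dual_group G).
        (\<Sum>(\<chi>', \<chi>'') \<in> {(\<chi>', \<chi>''). \<chi>' \<in> carrier (dual_group G) \<and> \<chi>'' \<in> carrier (dual_group G) \<and>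
             inv\<^bsub>dual_group G\<^esub> \<chi>' \<otimes>\<^bsub>dual_group G\<^esub> \<chi>'' = \<chi>}. Q \<chi>' \<chi>'')
        = fourier_coeff G f \<chi>) \<and>
     hermitian_psd (carrier (dual_group G)) Q"

definition sdp_objective ::
    "('a, 'b) monoid_scheme \<Rightarrow> (('a \<Rightarrow> complex) \<Rightarrow> ('a \<Rightarrow> complex) \<Rightarrow> complex) \<Rightarrow> complex" where
  "sdp_objective G Q =
     (\<Sum>\<chi>\<in>carrier (dual_group G) - {\<one>\<^bsub>dual_group G\<^esub>}. Q \<chi> \<chi>)"

text \<open>
  The objective is real at every feasible point, a Hermitian matrix having a real diagonal, so
  comparing objective values in the complex order compares real numbers.
\<close>

definition sdp_optimal ::
    "('a, 'b) monoid_scheme \<Rightarrow> ('a \<Rightarrow> complex) \<Rightarrow>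
     (('a \<Rightarrow> complex) \<Rightarrow> ('a \<Rightarrow> complex) \<Rightarrow> complex) \<Rightarrow> bool" where
  "sdp_optimal G f Q \<longleftrightarrow>
     sdp_feasible G f Q \<and>
     (\<forall>Q'. sdp_feasible G f Q' \<longrightarrow> sdp_objective G Q \<le> sdp_objective G Q')"

end

theory Submission
  imports Defs
begin

text \<open>
  Write \<open>Q[v]\<close> for \<open>v\<^sup>* Q v\<close>, and \<open>e\<^sub>x\<close> for the vector \<open>(\<chi> x)\<^sub>\<chi>\<close> of values at \<open>x\<close> of all characters.
  Since \<open>cnj (\<chi>' x) * \<chi>'' x\<close> is the value at \<open>x\<close> of \<open>\<chi>'\<^sup>-\<^sup>1 \<chi>''\<close>, and a function is determined by
  its Fourier coefficients, the linear constraints on \<open>Q\<close> say that \<open>Q[e\<^sub>x] = f x\<close> for all \<open>x\<close>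
  (\<open>sdp_feasible_iff\<close>). For \<open>Q0\<close>, the form is \<open>Q0[v] = \<bar>\<Sum>\<chi>. a \<chi> * v \<chi>\<bar>\<^sup>2\<close>, with value \<open>(h x)\<^sup>2 = f x\<close>
  at \<open>e\<^sub>x\<close>, so \<open>Q0\<close> is feasible.

  The constraint at the trivial character fixes the trace of \<open>Q\<close>. Hence the objective is a constant
  minus the diagonal entry of the trivial character, that is, minus \<open>Q[u]\<close> for the unit vector
  \<open>u\<close> of the trivial character (\<open>sdp_objective_feasible\<close>). Orthogonality of characters says that
  \<open>u\<close> is the average of the vectors \<open>e\<^sub>x\<close>. As \<open>sqrt Q[v]\<close> is a seminorm, \<open>sqrt Q[u]\<close> is at most the
  average of the numbers \<open>sqrt Q[e\<^sub>x] = sqrt (f x) = h x\<close> (\<open>feasible_corner_bound\<close>). This average is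
  the Fourier coefficient of \<open>h\<close> at the trivial character, whose square is the corresponding entry of
  \<open>Q0\<close>; so no feasible matrix has a larger entry there.

  The Fourier inversion formula rests on the fact that the characters separate the points of \<open>G\<close>
  (\<open>dual_separates_one\<close>), which follows by extending characters from subgroups, one generator at a time.
\<close>

section \<open>Characters of finite abelian groups\<close>

lemma mem_hom_nonzero_complex_iff:
  "\<chi> \<in> hom H nonzero_complex \<longleftrightarrow>
     (\<forall>x\<in>carrier H. \<chi> x \<noteq> 0) \<and>
     (\<forall>x\<in>carrier H. \<forall>y\<in>carrier H. \<chi> (x \<otimes>\<^bsub>H\<^esub> y) = \<chi> x * \<chi> y)"
  by (auto simp: hom_def nonzero_complex_def Pi_def)

locale finite_abelian_group = comm_group G for G (structure) +
  assumes finite_carrier: "finite (carrier G)"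
begin

abbreviation dual :: "('a \<Rightarrow> complex) set"
  where "dual \<equiv> carrier (dual_group G)"

lemma order_pos: "order G > 0"
  using finite_carrier order_gt_0_iff_finite by blast

text \<open>
  One step of extending a character: on the subgroup generated by \<open>H\<close> and \<open>y\<close>, the value \<open>z\<close> at \<open>y\<close>
  determines the extension, and the only restriction on \<open>z\<close> comes from the first power of \<open>y\<close> that
  falls into \<open>H\<close>. The choice of \<open>z\<close> is left open because it is used twice: with an arbitrary root when
  extending, and with a root other than \<open>1\<close> when separating \<open>y\<close> from the neutral element.
\<close>

lemma hom_on_subgroup_step:
  assumes H: "subgroup H G"
    and \<chi>: "\<chi> \<in> hom (G\<lparr>carrier := H\<rparr>) nonzero_complex"
    and y: "y \<in> carrier G" "y \<notin> H"
  obtains m where "m > 1" "y [^] m \<in> H"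
    "\<And>z. z ^ m = \<chi> (y [^] m) \<Longrightarrow>
       \<exists>K \<psi>. subgroup K G \<and> H \<subseteq> K \<and> y \<in> K \<and> \<psi> \<in> hom (G\<lparr>carrier := K\<rparr>) nonzero_complex \<and>
             (\<forall>x\<in>H. \<psi> x = \<chi> x) \<and> \<psi> y = z"
proof -
  interpret H: subgroup H G by (rule H)
  have \<chi>_nz: "\<chi> h \<noteq> 0" if "h \<in> H" for h
    using \<chi> that by (auto simp: mem_hom_nonzero_complex_iff)
  have \<chi>_mult: "\<chi> (h \<otimes> h') = \<chi> h * \<chi> h'" if "h \<in> H" "h' \<in> H" for h h'
    using \<chi> that by (auto simp: mem_hom_nonzero_complex_iff)
  have \<chi>_one: "\<chi> \<one> = 1"
    using \<chi>_mult[of \<one> \<one>] \<chi>_nz[of \<one>] by simp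
  have H_pow: "h [^] k \<in> H" if "h \<in> H" for h and k :: nat
    by (induction k) (use that in \<open>auto intro: H.m_closed\<close>)
  have \<chi>_pow: "\<chi> (h [^] k) = \<chi> h ^ k" if "h \<in> H" for h and k :: nat
    by (induction k) (use that in \<open>auto simp: \<chi>_one \<chi>_mult H_pow\<close>)
  have y_order: "y [^] order G = \<one>"
    using y(1) by (rule pow_order_eq_1)
  define m where "m = (LEAST n::nat. n > 0 \<and> y [^] n \<in> H)"
  have "m > 0 \<and> y [^] m \<in> H"
    unfolding m_def by (rule LeastI[of "\<lambda>n::nat. n > 0 \<and> y [^] n \<in> H" "order G"])
      (simp add: order_pos y_order)
  then have m_pos: "m > 0" and ym: "y [^] m \<in> H" by auto
  have m_min: "n = 0" if "y [^] n \<in> H" "n < m" for n :: nat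
    using not_less_Least[of n "\<lambda>n::nat. n > 0 \<and> y [^] n \<in> H"] that by (auto simp: m_def)
  have m_gt_1: "m > 1"
    using m_pos ym y by (cases "m = 1") auto
  have pow_split: "y [^] d = (y [^] m) [^] (d div m) \<otimes> y [^] (d mod m)" for d :: nat
    using y(1) by (simp add: nat_pow_pow nat_pow_mult)
  \<comment> \<open>Division with remainder: the exponents of \<open>y\<close> that lead into \<open>H\<close> are the multiples of \<open>m\<close>.\<close>
  have m_dvd: "m dvd d" if d: "y [^] d \<in> H" for d :: nat
  proof -
    define h r where "h = (y [^] m) [^] (d div m)" and "r = y [^] (d mod m)"
    have h: "h \<in> H" unfolding h_def by (rule H_pow[OF ym])
    have r: "r \<in> carrier G" unfolding r_def using y(1) by simp
    have "y [^] d = h \<otimes> r"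
      unfolding h_def r_def by (rule pow_split)
    then have "r = inv h \<otimes> y [^] d"
      using h r by (simp add: m_assoc[symmetric])
    then have "r \<in> H" using h d by simp
    then have "y [^] (d mod m) \<in> H" by (simp add: r_def)
    then have "d mod m = 0" using m_min m_pos mod_less_divisor by blast
    then show ?thesis by (simp add: dvd_eq_mod_eq_0)
  qed
  have "\<exists>K \<psi>. subgroup K G \<and> H \<subseteq> K \<and> y \<in> K \<and> \<psi> \<in> hom (G\<lparr>carrier := K\<rparr>) nonzero_complex \<and>
             (\<forall>x\<in>H. \<psi> x = \<chi> x) \<and> \<psi> y = z" if z: "z ^ m = \<chi> (y [^] m)" for z
  proof -
    have z_nz: "z \<noteq> 0"
      using z m_pos \<chi>_nz[OF ym] by (auto simp: power_0_left)
    have z_pow: "z ^ d = \<chi> (y [^] d)" if d: "y [^] d \<in> H" for d :: nat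
    proof -
      obtain q where q: "d = m * q" using m_dvd[OF d] by (rule dvdE)
      have "y [^] d = (y [^] m) [^] q"
        using y(1) by (simp add: q nat_pow_pow)
      then show ?thesis using ym by (simp add: q \<chi>_pow power_mult z)
    qed
    \<comment> \<open>The extension maps \<open>h \<otimes> y [^] k\<close> to \<open>\<chi> h * z ^ k\<close>; this does not depend on the
        representation.\<close>
    have wd_le: "\<chi> h * z ^ k = \<chi> h' * z ^ l"
      if h: "h \<in> H" "h' \<in> H" and eq: "h \<otimes> y [^] k = h' \<otimes> y [^] l" and kl: "k \<le> l" for h h' and k l :: nat
    proof -
      obtain d where d: "l = d + k" using kl by (metis le_add_diff_inverse2)
      have "h \<otimes> y [^] k = (h' \<otimes> y [^] d) \<otimes> y [^] k"
        using eq y(1) h by (simp add: d nat_pow_mult[symmetric] m_assoc)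
      then have hd: "h = h' \<otimes> y [^] d"
        using y(1) h by (metis H.mem_carrier m_closed nat_pow_closed r_cancel)
      then have "y [^] d = inv h' \<otimes> h"
        using y(1) h by (subst inv_solve_left) auto
      then have yd: "y [^] d \<in> H" using h by simp
      have "\<chi> h = \<chi> h' * z ^ d"
        using hd h yd by (simp add: \<chi>_mult z_pow)
      then show ?thesis by (simp add: d power_add)
    qed
    have wd: "\<chi> h * z ^ k = \<chi> h' * z ^ l"
      if "h \<in> H" "h' \<in> H" "h \<otimes> y [^] k = h' \<otimes> y [^] l" for h h' and k l :: nat
      using wd_le[of h h' k l] wd_le[of h' h l k] that by (cases "k \<le> l") auto
    define K where "K = {h \<otimes> y [^] k | h (k :: nat). h \<in> H}"
    define \<psi> where "\<psi> u = (SOME c. \<exists>h\<in>H. \<exists>k::nat. u = h \<otimes> y [^] k \<and> c = \<chi> h * z ^ k)" for u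
    have \<psi>_eq: "\<psi> (h \<otimes> y [^] k) = \<chi> h * z ^ k" if "h \<in> H" for h and k :: nat
      unfolding \<psi>_def by (rule some_equality) (use that wd in \<open>blast, metis\<close>)
    have mult_eq: "(h \<otimes> y [^] k) \<otimes> (h' \<otimes> y [^] l) = (h \<otimes> h') \<otimes> y [^] (k + l)"
      if "h \<in> H" "h' \<in> H" for h h' and k l :: nat
      using that y(1) by (simp add: nat_pow_mult[symmetric] m_ac)
    have H_K: "H \<subseteq> K"
    proof
      fix h assume "h \<in> H"
      then have "h = h \<otimes> y [^] (0::nat)" by simp
      with \<open>h \<in> H\<close> show "h \<in> K" unfolding K_def by blast
    qed
    have y_eq: "\<one> \<otimes> y [^] (1::nat) = y" using y(1) by simp
    have "subgroup K G"
    proof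
      show "K \<subseteq> carrier G" using y(1) by (auto simp: K_def)
      show "\<one> \<in> K" using H_K by auto
      show "u \<otimes> v \<in> K" if u: "u \<in> K" and v: "v \<in> K" for u v
      proof -
        obtain h k h' l where "u = h \<otimes> y [^] (k::nat)" "h \<in> H" "v = h' \<otimes> y [^] (l::nat)" "h' \<in> H"
          using u v unfolding K_def by blast
        then show ?thesis unfolding K_def using mult_eq[of h h' k l] by blast
      qed
      show "inv u \<in> K" if u: "u \<in> K" for u
      proof -
        obtain h k where hk: "u = h \<otimes> y [^] (k::nat)" "h \<in> H" using u unfolding K_def by blast
        \<comment> \<open>As only natural exponents occur in \<open>K\<close>, the inverse of \<open>y\<close> is written as its power
            with exponent \<open>order G - 1\<close>.\<close>
        let ?v = "inv h \<otimes> y [^] ((order G - 1) * k)"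
        have "k + (order G - 1) * k = order G * k"
          using order_pos by (cases "order G") auto
        then have "u \<otimes> ?v = (h \<otimes> inv h) \<otimes> (y [^] order G) [^] k"
          using hk y(1) by (simp add: mult_eq nat_pow_pow)
        also have "\<dots> = \<one>" using hk(2) by (simp add: y_order)
        finally have "inv u = ?v" using hk y(1)
          by (metis H.m_inv_closed H.mem_carrier inv_equality m_closed m_comm nat_pow_closed)
        then show ?thesis unfolding K_def using hk by blast
      qed
    qed
    moreover have "y \<in> K"
      unfolding K_def by (rule CollectI, rule exI[of _ \<one>], rule exI[of _ 1]) (use y_eq in simp)
    moreover have "\<psi> y = z"
      using \<psi>_eq[OF H.one_closed, of 1] unfolding y_eq by (simp add: \<chi>_one)
    moreover have "\<forall>x\<in>H. \<psi> x = \<chi> x"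
    proof
      fix x assume "x \<in> H"
      then show "\<psi> x = \<chi> x" using \<psi>_eq[of x 0] by simp
    qed
    moreover have "\<psi> \<in> hom (G\<lparr>carrier := K\<rparr>) nonzero_complex"
      unfolding mem_hom_nonzero_complex_iff
    proof (intro conjI ballI)
      fix u assume "u \<in> carrier (G\<lparr>carrier := K\<rparr>)"
      then obtain h k where "u = h \<otimes> y [^] (k::nat)" "h \<in> H" unfolding K_def by auto
      then show "\<psi> u \<noteq> 0" using \<chi>_nz z_nz by (simp add: \<psi>_eq)
    next
      fix u v assume "u \<in> carrier (G\<lparr>carrier := K\<rparr>)" "v \<in> carrier (G\<lparr>carrier := K\<rparr>)"
      then obtain h k h' l where "u = h \<otimes> y [^] (k::nat)" "h \<in> H" "v = h' \<otimes> y [^] (l::nat)" "h' \<in> H"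
        unfolding K_def by auto
      then show "\<psi> (u \<otimes>\<^bsub>G\<lparr>carrier := K\<rparr>\<^esub> v) = \<psi> u * \<psi> v"
        by (simp add: mult_eq \<psi>_eq \<chi>_mult power_add)
    qed
    ultimately show ?thesis using H_K by blast
  qed
  then show thesis using that m_gt_1 ym by blast
qed

lemma hom_on_subgroup_extends:
  assumes "subgroup H G" "\<chi> \<in> hom (G\<lparr>carrier := H\<rparr>) nonzero_complex"
  shows "\<exists>\<psi>\<in>dual. \<forall>x\<in>H. \<psi> x = \<chi> x"
  using assms
proof (induction "card (carrier G - H)" arbitrary: H \<chi> rule: less_induct)
  case less
  have sub: "H \<subseteq> carrier G" using less.prems(1) by (rule subgroup.subset)
  show ?case
  proof (cases "H = carrier G")
    case True
    then have "restrict \<chi> (carrier G) \<in> dual"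
      using less.prems(2) by (auto simp: dual_group_def mem_hom_nonzero_complex_iff)
    then show ?thesis using True by (intro bexI) auto
  next
    case False
    then obtain y where y: "y \<in> carrier G" "y \<notin> H" using sub by blast
    obtain m where m: "m > 1" "y [^] m \<in> H"
      "\<And>z. z ^ m = \<chi> (y [^] m) \<Longrightarrow>
       \<exists>K \<psi>. subgroup K G \<and> H \<subseteq> K \<and> y \<in> K \<and> \<psi> \<in> hom (G\<lparr>carrier := K\<rparr>) nonzero_complex \<and>
             (\<forall>x\<in>H. \<psi> x = \<chi> x) \<and> \<psi> y = z"
      using hom_on_subgroup_step[OF less.prems y] by blast
    have "\<chi> (y [^] m) \<noteq> 0"
      using less.prems(2) m(2) by (auto simp: mem_hom_nonzero_complex_iff)
    then have "card {z. z ^ m = \<chi> (y [^] m)} = m" using m(1) by (intro card_nth_roots) auto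
    then obtain z where "z ^ m = \<chi> (y [^] m)" using m(1) by fastforce
    from m(3)[OF this] obtain K \<psi> where K: "subgroup K G" "H \<subseteq> K" "y \<in> K"
      "\<psi> \<in> hom (G\<lparr>carrier := K\<rparr>) nonzero_complex" "\<forall>x\<in>H. \<psi> x = \<chi> x" by blast
    have "card (carrier G - K) < card (carrier G - H)"
      by (rule psubset_card_mono) (use K y finite_carrier in auto)
    from less.hyps[OF this K(1,4)] K(2,5) show ?thesis by (metis subsetD)
  qed
qed

text \<open>
  The trivial character of the trivial subgroup is first extended to the cyclic subgroup generated by
  \<open>x\<close>, where the value at \<open>x\<close> can be any root of unity of the right order, and then to \<open>G\<close>.
\<close>

lemma dual_separates_one:
  assumes x: "x \<in> carrier G" "x \<noteq> \<one>"
  obtains \<chi> where "\<chi> \<in> dual" "\<chi> x \<noteq> 1"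
proof -
  have triv: "(\<lambda>_. 1) \<in> hom (G\<lparr>carrier := {\<one>}\<rparr>) nonzero_complex"
    by (simp add: mem_hom_nonzero_complex_iff)
  have "x \<notin> {\<one>}" using x by simp
  from hom_on_subgroup_step[OF triv_subgroup triv x(1) this]
  obtain m where m: "m > 1"
    "\<And>z. z ^ m = 1 \<Longrightarrow>
       \<exists>K \<psi>. subgroup K G \<and> {\<one>} \<subseteq> K \<and> x \<in> K \<and> \<psi> \<in> hom (G\<lparr>carrier := K\<rparr>) nonzero_complex \<and>
             (\<forall>x\<in>{\<one>}. \<psi> x = 1) \<and> \<psi> x = z"
    by blast
  have "card {z::complex. z ^ m = 1} = m" using m(1) by (intro card_nth_roots) auto
  then have "\<not> {z::complex. z ^ m = 1} \<subseteq> {1}"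
    using m(1) card_mono[of "{1::complex}" "{z. z ^ m = 1}"] by auto
  then obtain z :: complex where z: "z ^ m = 1" "z \<noteq> 1" by blast
  from m(2)[OF z(1)] obtain K \<psi> where "subgroup K G" "x \<in> K"
    "\<psi> \<in> hom (G\<lparr>carrier := K\<rparr>) nonzero_complex" "\<psi> x = z" by blast
  with hom_on_subgroup_extends[of K \<psi>] z(2) that show thesis by metis
qed

section \<open>The dual group and orthogonality\<close>

lemma dual_iff:
  "\<chi> \<in> dual \<longleftrightarrow> \<chi> \<in> extensional (carrier G) \<and> (\<forall>x\<in>carrier G. \<chi> x \<noteq> 0) \<and>
     (\<forall>x\<in>carrier G. \<forall>y\<in>carrier G. \<chi> (x \<otimes> y) = \<chi> x * \<chi> y)"
  by (auto simp: dual_group_def mem_hom_nonzero_complex_iff)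

lemma dual_nonzero: "\<chi> \<in> dual \<Longrightarrow> x \<in> carrier G \<Longrightarrow> \<chi> x \<noteq> 0"
  by (simp add: dual_iff)

lemma dual_mult: "\<chi> \<in> dual \<Longrightarrow> x \<in> carrier G \<Longrightarrow> y \<in> carrier G \<Longrightarrow> \<chi> (x \<otimes> y) = \<chi> x * \<chi> y"
  by (simp add: dual_iff)

lemma dual_at_one: "\<chi> \<in> dual \<Longrightarrow> \<chi> \<one> = 1"
  using dual_mult[of \<chi> \<one> \<one>] dual_nonzero[of \<chi> \<one>] by simp

lemma dual_pow: "\<chi> \<in> dual \<Longrightarrow> x \<in> carrier G \<Longrightarrow> \<chi> (x [^] (n::nat)) = \<chi> x ^ n"
  by (induction n) (auto simp: dual_at_one dual_mult)

lemma dual_pow_order: "\<chi> \<in> dual \<Longrightarrow> x \<in> carrier G \<Longrightarrow> \<chi> x ^ order G = 1"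
  by (metis dual_at_one dual_pow pow_order_eq_1)

text \<open>
  All values are roots of unity, hence inverses of characters are complex conjugates.
\<close>

lemma norm_dual: "\<chi> \<in> dual \<Longrightarrow> x \<in> carrier G \<Longrightarrow> cmod (\<chi> x) = 1"
  using power_eq_1_iff[OF dual_pow_order] order_pos by fastforce

lemma cnj_dual_mult: "\<chi> \<in> dual \<Longrightarrow> x \<in> carrier G \<Longrightarrow> cnj (\<chi> x) * \<chi> x = 1"
  using complex_norm_square[of "\<chi> x"] by (simp add: norm_dual mult.commute)

lemma dual_inv: "\<chi> \<in> dual \<Longrightarrow> x \<in> carrier G \<Longrightarrow> \<chi> (inv x) = cnj (\<chi> x)"
  using dual_mult[of \<chi> "inv x" x] cnj_dual_mult[of \<chi> x] dual_nonzero[of \<chi> x]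
  by (simp add: dual_at_one) (metis mult_right_cancel)

lemma finite_dual: "finite dual"
proof (rule finite_subset)
  show "dual \<subseteq> (\<Pi>\<^sub>E x\<in>carrier G. {z. z ^ order G = 1})"
    by (auto simp: PiE_def dual_pow_order) (simp add: dual_iff)
  show "finite (\<Pi>\<^sub>E x\<in>carrier G. {z::complex. z ^ order G = 1})"
    using order_pos by (intro finite_PiE finite_carrier finite_roots_unity) auto
qed

lemma dual_eqI:
  assumes "\<chi> \<in> dual" "\<psi> \<in> dual" "\<And>x. x \<in> carrier G \<Longrightarrow> \<chi> x = \<psi> x"
  shows "\<chi> = \<psi>"
  by (rule extensionalityI[of _ "carrier G"]) (use assms in \<open>auto simp: dual_iff\<close>)

lemma one_dual: "\<one>\<^bsub>dual_group G\<^esub> = (\<lambda>x\<in>carrier G. 1)"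
  and mult_dual: "\<chi> \<otimes>\<^bsub>dual_group G\<^esub> \<psi> = (\<lambda>x\<in>carrier G. \<chi> x * \<psi> x)"
  by (simp_all add: dual_group_def)

lemma cnj_in_dual: "\<chi> \<in> dual \<Longrightarrow> (\<lambda>x\<in>carrier G. cnj (\<chi> x)) \<in> dual"
  by (auto simp: dual_iff)

lemma group_dual: "group (dual_group G)"
proof (rule groupI)
  show "\<exists>\<psi>\<in>dual. \<psi> \<otimes>\<^bsub>dual_group G\<^esub> \<chi> = \<one>\<^bsub>dual_group G\<^esub>" if "\<chi> \<in> dual" for \<chi>
    by (rule bexI[OF _ cnj_in_dual[OF that]])
      (auto simp: one_dual mult_dual restrict_def fun_eq_iff cnj_dual_mult that)
  show "\<one>\<^bsub>dual_group G\<^esub> \<otimes>\<^bsub>dual_group G\<^esub> \<chi> = \<chi>" if "\<chi> \<in> dual" for \<chi>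
    by (rule extensionalityI[of _ "carrier G"]) (use that in \<open>auto simp: mult_dual one_dual dual_iff\<close>)
qed (auto simp: one_dual mult_dual dual_iff restrict_def extensional_def fun_eq_iff)

sublocale dual: group "dual_group G"
  by (rule group_dual)

lemma inv_dual: "\<chi> \<in> dual \<Longrightarrow> inv\<^bsub>dual_group G\<^esub> \<chi> = (\<lambda>x\<in>carrier G. cnj (\<chi> x))"
  by (rule dual.inv_equality)
    (auto simp: one_dual mult_dual restrict_def fun_eq_iff cnj_dual_mult cnj_in_dual[unfolded restrict_def])

text \<open>
  Translating the summation variable by \<open>y\<close> multiplies the sum by \<open>\<chi> y\<close>, which differs from \<open>1\<close> for
  some \<open>y\<close> unless \<open>\<chi>\<close> is trivial.
\<close>

lemma sum_dual_over_group:
  assumes "\<chi> \<in> dual"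
  shows "(\<Sum>x\<in>carrier G. \<chi> x) = (if \<chi> = \<one>\<^bsub>dual_group G\<^esub> then of_nat (order G) else 0)"
proof (cases "\<chi> = \<one>\<^bsub>dual_group G\<^esub>")
  case True
  then show ?thesis by (simp add: one_dual order_def)
next
  case False
  then obtain y where y: "y \<in> carrier G" "\<chi> y \<noteq> 1"
    using dual_eqI[OF assms dual.one_closed] by (auto simp: one_dual)
  have "\<chi> y * (\<Sum>x\<in>carrier G. \<chi> x) = (\<Sum>x\<in>carrier G. \<chi> (y \<otimes> x))"
    using assms y by (simp add: sum_distrib_left dual_mult)
  also have "\<dots> = (\<Sum>x\<in>carrier G. \<chi> x)"
    by (rule sum.reindex_bij_witness[of _ "\<lambda>x. inv y \<otimes> x" "\<lambda>x. y \<otimes> x"])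
      (use y in \<open>auto simp: m_assoc[symmetric]\<close>)
  finally show ?thesis using y False by simp
qed

text \<open>
  The argument for the other variable multiplies the summation variable by a character separating \<open>x\<close> from the neutral
  element. It leaves the value \<open>card dual\<close> at the neutral element, which is identified with \<open>order G\<close>
  by evaluating the sum of \<open>\<chi> x\<close> over all pairs in both orders.
\<close>

lemma sum_group_over_dual:
  assumes x: "x \<in> carrier G"
  shows "(\<Sum>\<chi>\<in>dual. \<chi> x) = (if x = \<one> then of_nat (order G) else 0)"
proof -
  have off: "(\<Sum>\<chi>\<in>dual. \<chi> x) = 0" if x: "x \<in> carrier G" "x \<noteq> \<one>" for x
  proof -
    obtain \<psi> where \<psi>: "\<psi> \<in> dual" "\<psi> x \<noteq> 1" using dual_separates_one[OF x] .
    have "\<psi> x * (\<Sum>\<chi>\<in>dual. \<chi> x) = (\<Sum>\<chi>\<in>dual. (\<psi> \<otimes>\<^bsub>dual_group G\<^esub> \<chi>) x)"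
      using x by (simp add: sum_distrib_left mult_dual)
    also have "\<dots> = (\<Sum>\<chi>\<in>dual. \<chi> x)"
      by (rule sum.reindex_bij_witness[of _ "\<lambda>\<chi>. inv\<^bsub>dual_group G\<^esub> \<psi> \<otimes>\<^bsub>dual_group G\<^esub> \<chi>"
              "\<lambda>\<chi>. \<psi> \<otimes>\<^bsub>dual_group G\<^esub> \<chi>"])
        (use \<psi> in \<open>auto simp: dual.m_assoc[symmetric]\<close>)
    finally show ?thesis using \<psi> by simp
  qed
  have "of_nat (card dual) = (\<Sum>\<chi>\<in>dual. \<chi> \<one>)"
    by (simp add: dual_at_one)
  also have "\<dots> = (\<Sum>x\<in>carrier G. \<Sum>\<chi>\<in>dual. \<chi> x)"
    using finite_carrier off by (subst sum.remove[of _ \<one>]) (auto intro!: sum.neutral)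
  also have "\<dots> = (\<Sum>\<chi>\<in>dual. if \<chi> = \<one>\<^bsub>dual_group G\<^esub> then of_nat (order G) else 0)"
    by (subst sum.swap) (simp add: sum_dual_over_group)
  also have "\<dots> = of_nat (order G)"
    using finite_dual by (simp add: sum.delta)
  finally have "(\<Sum>\<chi>\<in>dual. \<chi> \<one>) = of_nat (order G)"
    by (simp add: dual_at_one)
  then show ?thesis using off x by auto
qed

lemma inv_mult_dual_eq_one_iff:
  assumes "\<psi> \<in> dual" "\<chi> \<in> dual"
  shows "inv\<^bsub>dual_group G\<^esub> \<psi> \<otimes>\<^bsub>dual_group G\<^esub> \<chi> = \<one>\<^bsub>dual_group G\<^esub> \<longleftrightarrow> \<psi> = \<chi>"
  using assms by (metis dual.inv_solve_left dual.l_inv dual.one_closed dual.r_one)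

lemma inv_mult_dual_apply:
  assumes "\<psi> \<in> dual" "\<chi> \<in> dual" "x \<in> carrier G"
  shows "(inv\<^bsub>dual_group G\<^esub> \<psi> \<otimes>\<^bsub>dual_group G\<^esub> \<chi>) x = cnj (\<psi> x) * \<chi> x"
  using assms by (simp add: mult_dual inv_dual)

lemma dual_orthogonal:
  assumes "\<psi> \<in> dual" "\<chi> \<in> dual"
  shows "(\<Sum>x\<in>carrier G. cnj (\<psi> x) * \<chi> x) = (if \<psi> = \<chi> then of_nat (order G) else 0)"
proof -
  have "(\<Sum>x\<in>carrier G. cnj (\<psi> x) * \<chi> x)
      = (\<Sum>x\<in>carrier G. (inv\<^bsub>dual_group G\<^esub> \<psi> \<otimes>\<^bsub>dual_group G\<^esub> \<chi>) x)"
    using assms by (intro sum.cong refl inv_mult_dual_apply[symmetric]) auto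
  then show ?thesis
    using assms by (simp add: sum_dual_over_group inv_mult_dual_eq_one_iff)
qed

lemma evaluations_orthogonal:
  assumes "y \<in> carrier G" "x \<in> carrier G"
  shows "(\<Sum>\<chi>\<in>dual. cnj (\<chi> y) * \<chi> x) = (if y = x then of_nat (order G) else 0)"
proof -
  have "(\<Sum>\<chi>\<in>dual. cnj (\<chi> y) * \<chi> x) = (\<Sum>\<chi>\<in>dual. \<chi> (inv y \<otimes> x))"
    using assms by (intro sum.cong refl) (simp add: dual_mult dual_inv)
  moreover have "inv y \<otimes> x = \<one> \<longleftrightarrow> y = x"
    using assms by (metis inv_solve_left l_inv one_closed r_one)
  ultimately show ?thesis
    using assms by (simp add: sum_group_over_dual)
qed

section \<open>Fourier coefficients\<close>

lemma fourier_expansion_coeff: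
  assumes "is_fourier_expansion G f c" "\<chi> \<in> dual"
  shows "c \<chi> = (\<Sum>x\<in>carrier G. cnj (\<chi> x) * f x) / of_nat (order G)"
proof -
  have "(\<Sum>x\<in>carrier G. cnj (\<chi> x) * f x)
      = (\<Sum>x\<in>carrier G. \<Sum>\<psi>\<in>dual. c \<psi> * (cnj (\<chi> x) * \<psi> x))"
    using assms(1) unfolding is_fourier_expansion_def
    by (intro sum.cong refl) (simp add: sum_distrib_left mult_ac)
  also have "\<dots> = (\<Sum>\<psi>\<in>dual. c \<psi> * (if \<chi> = \<psi> then of_nat (order G) else 0))"
    by (subst sum.swap) (simp add: sum_distrib_left[symmetric] dual_orthogonal assms(2))
  also have "\<dots> = c \<chi> * of_nat (order G)"
    using finite_dual assms(2) by (simp add: if_distrib cong: if_cong)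
  finally show ?thesis using order_pos by simp
qed

lemma fourier_expansion_exists:
  "is_fourier_expansion G f (\<lambda>\<chi>. (\<Sum>y\<in>carrier G. cnj (\<chi> y) * f y) / of_nat (order G))"
  unfolding is_fourier_expansion_def
proof
  fix x assume x: "x \<in> carrier G"
  have "(\<Sum>\<chi>\<in>dual. (\<Sum>y\<in>carrier G. cnj (\<chi> y) * f y) / of_nat (order G) * \<chi> x)
      = (\<Sum>\<chi>\<in>dual. \<Sum>y\<in>carrier G. f y / of_nat (order G) * (cnj (\<chi> y) * \<chi> x))"
    by (simp add: sum_distrib_left sum_distrib_right sum_divide_distrib mult_ac)
  also have "\<dots> = (\<Sum>y\<in>carrier G. f y / of_nat (order G) * (\<Sum>\<chi>\<in>dual. cnj (\<chi> y) * \<chi> x))"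
    by (subst sum.swap) (simp only: sum_distrib_left)
  also have "\<dots> = (\<Sum>y\<in>carrier G. f y / of_nat (order G) * (if y = x then of_nat (order G) else 0))"
    by (simp add: evaluations_orthogonal x cong: sum.cong)
  also have "\<dots> = f x"
    using finite_carrier x order_pos by (simp add: if_distrib cong: if_cong)
  finally show "f x = (\<Sum>\<chi>\<in>dual. (\<Sum>y\<in>carrier G. cnj (\<chi> y) * f y) / of_nat (order G) * \<chi> x)" ..
qed

lemma is_fourier_expansion_cong:
  assumes "\<And>\<chi>. \<chi> \<in> dual \<Longrightarrow> c \<chi> = d \<chi>"
  shows "is_fourier_expansion G f c \<longleftrightarrow> is_fourier_expansion G f d"
  unfolding is_fourier_expansion_def using assms by (simp cong: sum.cong)

lemma fourier_coeff_eq: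
  assumes "\<chi> \<in> dual"
  shows "fourier_coeff G f \<chi> = (\<Sum>x\<in>carrier G. cnj (\<chi> x) * f x) / of_nat (order G)"
proof -
  let ?c = "\<lambda>\<chi>\<in>dual. (\<Sum>x\<in>carrier G. cnj (\<chi> x) * f x) / of_nat (order G)"
  have "fourier_coeff G f = ?c"
    unfolding fourier_coeff_def
  proof (rule the_equality)
    show "?c \<in> extensional dual \<and> is_fourier_expansion G f ?c"
      using fourier_expansion_exists[of f] by (subst is_fourier_expansion_cong) auto
    show "c = ?c" if "c \<in> extensional dual \<and> is_fourier_expansion G f c" for c
      by (rule extensionalityI[of _ dual]) (use that fourier_expansion_coeff in auto)
  qed
  then show ?thesis using assms by simp
qed

lemma fourier_expansion_fourier_coeff: "is_fourier_expansion G f (fourier_coeff G f)"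
  using fourier_expansion_exists[of f]
  by (subst is_fourier_expansion_cong[OF fourier_coeff_eq])

lemma is_fourier_expansion_iff:
  "is_fourier_expansion G f c \<longleftrightarrow> (\<forall>\<chi>\<in>dual. c \<chi> = fourier_coeff G f \<chi>)"
proof
  assume "is_fourier_expansion G f c"
  then show "\<forall>\<chi>\<in>dual. c \<chi> = fourier_coeff G f \<chi>"
    by (simp add: fourier_expansion_coeff fourier_coeff_eq)
next
  assume "\<forall>\<chi>\<in>dual. c \<chi> = fourier_coeff G f \<chi>"
  then show "is_fourier_expansion G f c"
    using is_fourier_expansion_cong[of c "fourier_coeff G f" f] fourier_expansion_fourier_coeff by blast
qed

end

section \<open>Hermitian forms\<close>

definition sesq_form :: "'i set \<Rightarrow> ('i \<Rightarrow> 'i \<Rightarrow> complex) \<Rightarrow> ('i \<Rightarrow> complex) \<Rightarrow> ('i \<Rightarrow> complex) \<Rightarrow> complex"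
  where "sesq_form I Q v w = (\<Sum>i\<in>I. \<Sum>j\<in>I. cnj (v i) * Q i j * w j)"

lemma sesq_form_sum_left:
  "sesq_form I Q (\<lambda>i. \<Sum>x\<in>A. v x i) w = (\<Sum>x\<in>A. sesq_form I Q (v x) w)"
proof -
  have "sesq_form I Q (\<lambda>i. \<Sum>x\<in>A. v x i) w = (\<Sum>i\<in>I. \<Sum>x\<in>A. \<Sum>j\<in>I. cnj (v x i) * Q i j * w j)"
    unfolding sesq_form_def
    by (intro sum.cong refl, subst sum.swap) (simp add: sum_distrib_right)
  then show ?thesis unfolding sesq_form_def by (simp add: sum.swap[of _ A])
qed

lemma sesq_form_sum_right:
  "sesq_form I Q v (\<lambda>i. \<Sum>x\<in>A. w x i) = (\<Sum>x\<in>A. sesq_form I Q v (w x))"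
proof -
  have "sesq_form I Q v (\<lambda>i. \<Sum>x\<in>A. w x i) = (\<Sum>i\<in>I. \<Sum>x\<in>A. \<Sum>j\<in>I. cnj (v i) * Q i j * w x j)"
    unfolding sesq_form_def
    by (intro sum.cong refl, subst sum.swap) (simp add: sum_distrib_left)
  then show ?thesis unfolding sesq_form_def by (simp add: sum.swap[of _ A])
qed

lemma sesq_form_cnj:
  assumes "hermitian_psd I Q"
  shows "sesq_form I Q w v = cnj (sesq_form I Q v w)"
proof -
  have "cnj (sesq_form I Q v w) = (\<Sum>i\<in>I. \<Sum>j\<in>I. cnj (w j) * Q j i * v i)"
    unfolding sesq_form_def cnj_sum
  proof (intro sum.cong refl)
    fix i j assume "i \<in> I" "j \<in> I"
    then have "Q j i = cnj (Q i j)"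
      using assms unfolding hermitian_psd_def by blast
    then show "cnj (cnj (v i) * Q i j * w j) = cnj (w j) * Q j i * v i"
      by (simp only: complex_cnj_mult complex_cnj_cnj mult_ac)
  qed
  then show ?thesis unfolding sesq_form_def by (subst sum.swap) simp
qed

lemma sesq_form_nonneg:
  assumes "hermitian_psd I Q"
  shows "0 \<le> Re (sesq_form I Q v v)"
proof -
  have "0 \<le> sesq_form I Q v v"
    using assms unfolding hermitian_psd_def sesq_form_def by blast
  then show ?thesis by (simp add: less_eq_complex_def)
qed

text \<open>
  The form may be degenerate, so no division by the seminorm of \<open>w\<close> is possible in general; the proof
  uses the nonnegativity of the real quadratic polynomial \<open>t \<mapsto> \<parallel>v + t w\<parallel>\<^sup>2\<close>.
\<close>

lemma sesq_form_cauchy_schwarz: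
  assumes "hermitian_psd I Q"
  shows "Re (sesq_form I Q v w) \<le> sqrt (Re (sesq_form I Q v v)) * sqrt (Re (sesq_form I Q w w))"
proof -
  let ?A = "Re (sesq_form I Q v v)" and ?B = "Re (sesq_form I Q v w)"
    and ?C = "Re (sesq_form I Q w w)"
  have quad: "0 \<le> ?A + 2 * t * ?B + t\<^sup>2 * ?C" for t :: real
  proof -
    have "sesq_form I Q (\<lambda>i. v i + t * w i) (\<lambda>i. v i + t * w i)
       = sesq_form I Q v v + t * (sesq_form I Q v w + sesq_form I Q w v) + t\<^sup>2 * sesq_form I Q w w"
      unfolding sesq_form_def sum_distrib_left sum.distrib[symmetric]
      by (intro sum.cong refl) (simp add: algebra_simps power2_eq_square)
    then have "Re (sesq_form I Q (\<lambda>i. v i + t * w i) (\<lambda>i. v i + t * w i)) = ?A + 2 * t * ?B + t\<^sup>2 * ?C"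
      using sesq_form_cnj[OF assms, of w v] by (simp add: power2_eq_square)
    then show ?thesis using sesq_form_nonneg[OF assms] by metis
  qed
  have A: "0 \<le> ?A" and C: "0 \<le> ?C" using sesq_form_nonneg[OF assms] by auto
  have "?B\<^sup>2 \<le> ?A * ?C"
  proof (cases "?C = 0")
    case True
    \<comment> \<open>An affine function that is bounded below has slope zero; the chosen \<open>t\<close> is the point
        where it would be negative.\<close>
    have "?B = 0"
    proof (rule ccontr)
      assume "?B \<noteq> 0"
      then show False using quad[of "- (?A + 1) / (2 * ?B)"] True by (simp add: field_simps)
    qed
    then show ?thesis using True by simp
  next
    case False
    then have C_pos: "0 < ?C" using C by simp
    \<comment> \<open>The minimum of the polynomial is at \<open>t = - ?B / ?C\<close>.\<close>
    have "0 \<le> ?A - ?B\<^sup>2 / ?C"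
      using quad[of "- ?B / ?C"] C_pos by (simp add: power2_eq_square field_simps)
    then show ?thesis using C_pos by (simp add: field_simps)
  qed
  then have "?B \<le> sqrt (?A * ?C)" by (rule real_le_rsqrt)
  then show ?thesis by (simp add: real_sqrt_mult)
qed

lemma sesq_form_triangle:
  assumes "hermitian_psd I Q"
  shows "Re (sesq_form I Q (\<lambda>i. \<Sum>x\<in>A. v x i) (\<lambda>i. \<Sum>x\<in>A. v x i))
           \<le> (\<Sum>x\<in>A. sqrt (Re (sesq_form I Q (v x) (v x))))\<^sup>2"
proof -
  have "Re (sesq_form I Q (\<lambda>i. \<Sum>x\<in>A. v x i) (\<lambda>i. \<Sum>x\<in>A. v x i))
      = (\<Sum>x\<in>A. \<Sum>y\<in>A. Re (sesq_form I Q (v x) (v y)))"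
    by (simp add: sesq_form_sum_left sesq_form_sum_right)
  also have "\<dots> \<le> (\<Sum>x\<in>A. \<Sum>y\<in>A. sqrt (Re (sesq_form I Q (v x) (v x))) * sqrt (Re (sesq_form I Q (v y) (v y))))"
    by (intro sum_mono sesq_form_cauchy_schwarz assms)
  finally show ?thesis by (simp add: power2_eq_square sum_product)
qed

lemma sesq_form_rank_one:
  assumes "\<And>i j. i \<in> I \<Longrightarrow> j \<in> I \<Longrightarrow> Q i j = cnj (a i) * a j"
  shows "sesq_form I Q v w = cnj (\<Sum>i\<in>I. a i * v i) * (\<Sum>j\<in>I. a j * w j)"
  unfolding sesq_form_def cnj_sum sum_product
  by (intro sum.cong refl) (simp add: assms)

lemma hermitian_psd_rank_one:
  assumes "\<And>i j. i \<in> I \<Longrightarrow> j \<in> I \<Longrightarrow> Q i j = cnj (a i) * a j"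
  shows "hermitian_psd I Q"
proof -
  have "0 \<le> cnj z * z" for z
    by (simp add: less_eq_complex_def)
  then have "0 \<le> sesq_form I Q v v" for v
    by (simp only: sesq_form_rank_one[OF assms])
  then show ?thesis
    unfolding hermitian_psd_def sesq_form_def using assms by simp
qed

section \<open>The semidefinite program\<close>

context finite_abelian_group
begin

text \<open>
  The index pairs with a given quotient character form a (generalized) diagonal of the matrix, as
  for a Toeplitz matrix; the linear constraints fix the sums over these diagonals.
\<close>

definition diagonal_sum :: "(('a \<Rightarrow> complex) \<Rightarrow> ('a \<Rightarrow> complex) \<Rightarrow> complex) \<Rightarrow> ('a \<Rightarrow> complex) \<Rightarrow> complex"
  where "diagonal_sum Q \<chi> =
     (\<Sum>(\<chi>', \<chi>'') \<in> {(\<chi>', \<chi>''). \<chi>' \<in> dual \<and> \<chi>'' \<in> dual \<and>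
             inv\<^bsub>dual_group G\<^esub> \<chi>' \<otimes>\<^bsub>dual_group G\<^esub> \<chi>'' = \<chi>}. Q \<chi>' \<chi>'')"

text \<open>
  The constraints of the program prescribe Fourier coefficients, and this lemma identifies the
  function that has them. In the Hermitian form evaluated at the vector \<open>(\<chi> x)\<^sub>\<chi>\<close>, the entry
  \<open>Q \<chi>' \<chi>''\<close> is multiplied by \<open>cnj (\<chi>' x) * \<chi>'' x\<close>, which is the value at \<open>x\<close> of the character
  \<open>\<chi>'\<^sup>-\<^sup>1 \<chi>''\<close>; collecting the entries with equal quotient character gives a Fourier expansion.
\<close>

lemma fourier_expansion_diagonal_sum:
  "is_fourier_expansion G (\<lambda>x. sesq_form dual Q (\<lambda>\<chi>. \<chi> x) (\<lambda>\<chi>. \<chi> x)) (diagonal_sum Q)"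
  unfolding is_fourier_expansion_def
proof
  fix x assume x: "x \<in> carrier G"
  let ?q = "\<lambda>(\<chi>', \<chi>''). inv\<^bsub>dual_group G\<^esub> \<chi>' \<otimes>\<^bsub>dual_group G\<^esub> \<chi>''"
  have "(\<Sum>\<chi>\<in>dual. diagonal_sum Q \<chi> * \<chi> x)
      = (\<Sum>\<chi>\<in>dual. \<Sum>p\<in>{p \<in> dual \<times> dual. ?q p = \<chi>}. cnj (fst p x) * Q (fst p) (snd p) * snd p x)"
  proof (intro sum.cong refl)
    fix \<chi>
    have "diagonal_sum Q \<chi> * \<chi> x
        = (\<Sum>p\<in>{p \<in> dual \<times> dual. ?q p = \<chi>}. Q (fst p) (snd p) * \<chi> x)"
      unfolding diagonal_sum_def sum_distrib_right by (intro sum.cong) auto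
    also have "\<dots> = (\<Sum>p\<in>{p \<in> dual \<times> dual. ?q p = \<chi>}. cnj (fst p x) * Q (fst p) (snd p) * snd p x)"
      by (intro sum.cong refl) (auto simp: inv_mult_dual_apply x)
    finally show "diagonal_sum Q \<chi> * \<chi> x = \<dots>" .
  qed
  also have "\<dots> = (\<Sum>p\<in>dual \<times> dual. cnj (fst p x) * Q (fst p) (snd p) * snd p x)"
    by (rule sum.group) (auto simp: finite_dual)
  also have "\<dots> = sesq_form dual Q (\<lambda>\<chi>. \<chi> x) (\<lambda>\<chi>. \<chi> x)"
    unfolding sesq_form_def by (subst sum.cartesian_product) (simp add: case_prod_unfold)
  finally show "sesq_form dual Q (\<lambda>\<chi>. \<chi> x) (\<lambda>\<chi>. \<chi> x) = (\<Sum>\<chi>\<in>dual. diagonal_sum Q \<chi> * \<chi> x)" ..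
qed

text \<open>
  In this form, the constraints say that \<open>f\<close> is the sum of squares encoded by \<open>Q\<close>, evaluated
  pointwise.
\<close>

lemma sdp_feasible_iff:
  "sdp_feasible G f Q \<longleftrightarrow>
     (\<forall>x\<in>carrier G. sesq_form dual Q (\<lambda>\<chi>. \<chi> x) (\<lambda>\<chi>. \<chi> x) = f x) \<and> hermitian_psd dual Q"
proof -
  have "(\<forall>\<chi>\<in>dual. diagonal_sum Q \<chi> = fourier_coeff G f \<chi>) \<longleftrightarrow> is_fourier_expansion G f (diagonal_sum Q)"
    by (simp add: is_fourier_expansion_iff)
  also have "\<dots> \<longleftrightarrow> (\<forall>x\<in>carrier G. sesq_form dual Q (\<lambda>\<chi>. \<chi> x) (\<lambda>\<chi>. \<chi> x) = f x)"
    using fourier_expansion_diagonal_sum[of Q] unfolding is_fourier_expansion_def by (metis (lifting))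
  finally show ?thesis
    unfolding sdp_feasible_def diagonal_sum_def by simp
qed

text \<open>
  The constraint at the trivial character fixes the trace, so that minimizing the objective means
  maximizing the one diagonal entry which the objective omits.
\<close>

lemma sdp_objective_feasible:
  assumes "sdp_feasible G f Q"
  shows "sdp_objective G Q
       = fourier_coeff G f \<one>\<^bsub>dual_group G\<^esub> - Q \<one>\<^bsub>dual_group G\<^esub> \<one>\<^bsub>dual_group G\<^esub>"
proof -
  have "diagonal_sum Q \<one>\<^bsub>dual_group G\<^esub> = (\<Sum>\<chi>\<in>dual. Q \<chi> \<chi>)"
    unfolding diagonal_sum_def
    by (rule sum.reindex_bij_witness[of _ "\<lambda>\<chi>. (\<chi>, \<chi>)" fst]) (auto simp: inv_mult_dual_eq_one_iff)
  moreover have "diagonal_sum Q \<one>\<^bsub>dual_group G\<^esub> = fourier_coeff G f \<one>\<^bsub>dual_group G\<^esub>"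
    using assms dual.one_closed unfolding sdp_feasible_def diagonal_sum_def by blast
  ultimately show ?thesis
    unfolding sdp_objective_def using finite_dual by (simp add: sum_diff1)
qed

text \<open>
  By orthogonality, the sum over the group of the evaluation vectors \<open>(\<chi> x)\<^sub>\<chi>\<close> is \<open>order G\<close> times the
  unit vector of the trivial character. The triangle inequality for the seminorm
  of \<open>Q\<close> therefore bounds the seminorm of that unit vector by the seminorms of the evaluation
  vectors, and these are the numbers \<open>sqrt (f x)\<close> for every feasible matrix.
\<close>

lemma feasible_corner_bound:
  assumes "sdp_feasible G (\<lambda>x. complex_of_real (f x)) Q"
  shows "(of_nat (order G))\<^sup>2 * Re (Q \<one>\<^bsub>dual_group G\<^esub> \<one>\<^bsub>dual_group G\<^esub>) \<le> (\<Sum>x\<in>carrier G. sqrt (f x))\<^sup>2"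
proof -
  let ?e = "\<lambda>\<chi>. \<Sum>x\<in>carrier G. \<chi> x" and ?triv = "\<one>\<^bsub>dual_group G\<^esub>"
  have form: "sesq_form dual Q (\<lambda>\<chi>. \<chi> x) (\<lambda>\<chi>. \<chi> x) = f x" if "x \<in> carrier G" for x
    using assms that by (simp add: sdp_feasible_iff)
  have psd: "hermitian_psd dual Q" using assms by (simp add: sdp_feasible_iff)
  have "sesq_form dual Q ?e ?e
      = (\<Sum>i\<in>dual. if i = ?triv then \<Sum>j\<in>dual. if j = ?triv then (of_nat (order G))\<^sup>2 * Q ?triv ?triv else 0 else 0)"
    unfolding sesq_form_def
    by (intro sum.cong refl)
      (auto simp: sum_dual_over_group power2_eq_square simp del: cnj_sum intro!: sum.cong)
  also have "\<dots> = (of_nat (order G))\<^sup>2 * Q ?triv ?triv"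
    using finite_dual dual.one_closed by simp
  finally have corner: "Re (sesq_form dual Q ?e ?e) = (of_nat (order G))\<^sup>2 * Re (Q ?triv ?triv)"
    by (simp flip: of_nat_power)
  have "Re (sesq_form dual Q ?e ?e)
      \<le> (\<Sum>x\<in>carrier G. sqrt (Re (sesq_form dual Q (\<lambda>\<chi>. \<chi> x) (\<lambda>\<chi>. \<chi> x))))\<^sup>2"
    by (rule sesq_form_triangle[OF psd])
  then show ?thesis unfolding corner by (simp add: form)
qed

text \<open>
  The matrix \<open>Q0\<close> attains the bound: its seminorm is the absolute value of a linear functional, whose
  values \<open>h x\<close> at the evaluation vectors are all nonnegative, so that the triangle inequality is an
  equality.
\<close>

lemma sqrt_coeff_matrix_optimal:
  assumes f_nonneg: "\<And>x. x \<in> carrier G \<Longrightarrow> 0 \<le> f x"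
    and h: "\<And>x. x \<in> carrier G \<Longrightarrow> h x = sqrt (f x)"
    and a: "\<And>\<chi>. \<chi> \<in> dual \<Longrightarrow> a \<chi> = fourier_coeff G (\<lambda>x. complex_of_real (h x)) \<chi>"
    and Q0: "\<And>\<chi> \<chi>'. \<chi> \<in> dual \<Longrightarrow> \<chi>' \<in> dual \<Longrightarrow> Q0 \<chi> \<chi>' = cnj (a \<chi>) * a \<chi>'"
  shows "sdp_optimal G (\<lambda>x. complex_of_real (f x)) Q0"
  unfolding sdp_optimal_def
proof (intro conjI allI impI)
  let ?f = "\<lambda>x. complex_of_real (f x)" and ?triv = "\<one>\<^bsub>dual_group G\<^esub>"
  have "sesq_form dual Q0 (\<lambda>\<chi>. \<chi> x) (\<lambda>\<chi>. \<chi> x) = ?f x" if x: "x \<in> carrier G" for x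
  proof -
    have "is_fourier_expansion G (\<lambda>x. complex_of_real (h x)) a"
      using a by (simp add: is_fourier_expansion_iff)
    then have "(\<Sum>\<chi>\<in>dual. a \<chi> * \<chi> x) = h x"
      using x by (simp add: is_fourier_expansion_def)
    then have "sesq_form dual Q0 (\<lambda>\<chi>. \<chi> x) (\<lambda>\<chi>. \<chi> x) = complex_of_real (h x * h x)"
      by (simp add: sesq_form_rank_one[OF Q0] del: cnj_sum)
    then show ?thesis using h[OF x] f_nonneg[OF x] by simp
  qed
  then show feas0: "sdp_feasible G ?f Q0"
    using hermitian_psd_rank_one[of dual Q0 a, OF Q0] by (simp add: sdp_feasible_iff)
  fix Q assume feas: "sdp_feasible G ?f Q"
  have "a ?triv = complex_of_real ((\<Sum>x\<in>carrier G. sqrt (f x)) / order G)"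
    unfolding a[OF dual.one_closed] fourier_coeff_eq[OF dual.one_closed] by (simp add: one_dual h)
  then have Q0_corner: "Q0 ?triv ?triv = complex_of_real (((\<Sum>x\<in>carrier G. sqrt (f x)) / order G)\<^sup>2)"
    by (simp add: Q0 power2_eq_square)
  have "Re (Q ?triv ?triv) \<le> ((\<Sum>x\<in>carrier G. sqrt (f x)) / order G)\<^sup>2"
    using feasible_corner_bound[OF feas] order_pos by (simp add: power_divide field_simps)
  moreover have "Q ?triv ?triv = cnj (Q ?triv ?triv)"
    using feas dual.one_closed unfolding sdp_feasible_def hermitian_psd_def by blast
  then have "Im (Q ?triv ?triv) = 0" by (simp add: complex_eq_iff)
  ultimately have "Q ?triv ?triv \<le> Q0 ?triv ?triv"
    unfolding Q0_corner by (simp add: less_eq_complex_def)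
  then show "sdp_objective G Q0 \<le> sdp_objective G Q"
    by (simp add: sdp_objective_feasible[OF feas0] sdp_objective_feasible[OF feas])
qed

end

theorem theorem3p5:
  fixes G :: "('a, 'b) monoid_scheme"
    and f h :: "'a \<Rightarrow> real"
    and a :: "('a \<Rightarrow> complex) \<Rightarrow> complex"
    and Q0 :: "('a \<Rightarrow> complex) \<Rightarrow> ('a \<Rightarrow> complex) \<Rightarrow> complex"
  assumes "comm_group G"
    and "finite (carrier G)"
    and "\<forall>x\<in>carrier G. 0 \<le> f x"
    and "\<exists>x\<in>carrier G. f x \<noteq> 0"
    and "\<forall>x\<in>carrier G. h x = sqrt (f x)"
    and "\<forall>\<chi>\<in>carrier (dual_group G). a \<chi> = fourier_coeff G (\<lambda>x. complex_of_real (h x)) \<chi>"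
    and "\<forall>\<chi>\<in>carrier (dual_group G). \<forall>\<chi>'\<in>carrier (dual_group G). Q0 \<chi> \<chi>' = cnj (a \<chi>) * a \<chi>'"
  shows "sdp_optimal G (\<lambda>x. complex_of_real (f x)) Q0"
proof -
  interpret comm_group G by (rule assms(1))
  interpret finite_abelian_group G
    by unfold_locales (rule assms(2))
  show ?thesis
    by (rule sqrt_coeff_matrix_optimal[of f h a Q0]) (use assms in auto)
qed

end
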